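(* Let $d,q\ge 1$ be integers and let $n,m\in\mathscr{N}_{d,q}$ satisfy $n\prec_{\mathrm{maj}} m$. Then, component-wise, $$\mathscr{D}_n^{\downarrow}\le \mathscr{D}_m^{\downarrow},$$ i.e. for every $1\le j\le d!$, the $j$-th largest entry (with multiplicity) of the vector $\mathscr{D}_n=(D_n(\pi))_{\pi\in S_d}$ is at most the $j$-th largest entry of the vector $\mathscr{D}_m=(D_m(\pi))_{\pi\in S_d}$.
   Context: For integers $d,q\ge1$, $\mathscr{N}_{d,q}=\{n\in\mathbb{Z}_{\ge0}^q : n_1+\cdots+n_q=d\}$. For a real vector $a$, $a^{\downarrow}$ denotes its decreasing rearrangement (entries listed in nonincreasing order with multiplicity). For $a,b\in\mathbb{R}^q$, write $a\prec_{\mathrm{maj}} b$ if $\sum_{j=1}^{\ell}a_j^{\downarrow}\le\sum_{j=1}^{\ell}b_j^{\downarrow}$ for all $\ell=1,\ldots,q$, with equality when $\ell=q$. For $n\in\mathscr{N}_{d,q}$, the canonical word with multiplicity vector $n$ is $$t(n)=(\underbrace{1,\ldots,1}_{n_1},\underbrace{2,\ldots,2}_{n_2},\ldots,\underbrace{q,\ldots,q}_{n_q}),$$ a word of length $d$ with letters $t_1(n),\ldots,t_d(n)$. For $\pi\in S_d$ (the symmetric group on $\{1,\ldots,d\}$), the number of matching positions is $$D_n(\pi)=\#\{1\le i\le d : t_i(n)=t_{\pi(i)}(n)\},$$ and $\mathscr{D}_n=(D_n(\pi))_{\pi\in S_d}$ is the vector of these numbers indexed by permutations. *)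

theory Defs
  imports Complex_Main "HOL-Library.Multiset" "HOL-Combinatorics.Permutations"
begin

(* A vector of length q is a list of length q. List positions count from 0, so the i-th entry
   in the mathematical 1-based numbering is the list element at position i - 1. *)

definition multiplicity_vectors :: "nat \<Rightarrow> nat \<Rightarrow> nat list set" where
  "multiplicity_vectors d q = {n. length n = q \<and> sum_list n = d}"

(* The decreasing rearrangement depends only on the multiset of entries. Taking a multiset as
   argument covers both lists and families indexed by a finite set. *)
definition decreasing :: "'a::linorder multiset \<Rightarrow> 'a list" where
  "decreasing M = rev (sorted_list_of_multiset M)"

lemma mset_decreasing [simp]: "mset (decreasing M) = M"
  by (simp add: decreasing_def)

lemma length_decreasing [simp]: "length (decreasing M) = size M"
  by (metis mset_decreasing size_mset)

lemma sorted_decreasing: "sorted_wrt (\<ge>) (decreasing M)"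
  by (simp add: decreasing_def sorted_wrt_rev)

definition majorized :: "'a::{linorder,comm_monoid_add} list \<Rightarrow> 'a list \<Rightarrow> bool"
    (infix "\<prec>maj" 50) where
  "a \<prec>maj b \<longleftrightarrow> length a = length b \<and>
     (\<forall>l\<in>{1..length a}. (\<Sum>j=1..l. decreasing (mset a) ! (j - 1))
                       \<le> (\<Sum>j=1..l. decreasing (mset b) ! (j - 1))) \<and>
     (\<Sum>j=1..length a. decreasing (mset a) ! (j - 1))
       = (\<Sum>j=1..length a. decreasing (mset b) ! (j - 1))"

definition canonical_word :: "nat list \<Rightarrow> nat list" where
  "canonical_word n = concat (map (\<lambda>k. replicate (n ! (k - 1)) k) [1..<length n + 1])"

lemma length_canonical_word: "length (canonical_word n) = sum_list n"
proof -
  have "map (\<lambda>k. n ! (k - 1)) [1..<length n + 1] = n"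
    by (rule nth_equalityI) (auto simp del: upt_Suc)
  then show ?thesis
    by (simp add: canonical_word_def length_concat comp_def del: upt_Suc)
qed

lemma canonical_word_example: "canonical_word [2, 0, 3] = [1, 1, 3, 3, 3]"
  by (simp add: canonical_word_def upt_rec numeral_eq_Suc)

definition letter :: "nat list \<Rightarrow> nat \<Rightarrow> nat" where
  "letter n i = canonical_word n ! (i - 1)"

(* Permutations of {1..d} are functions on nat that are the identity outside {1..d};
   here d is the sum of the entries of n. *)
definition matches :: "nat list \<Rightarrow> (nat \<Rightarrow> nat) \<Rightarrow> nat" where
  "matches n \<pi> = card {i \<in> {1..sum_list n}. letter n i = letter n (\<pi> i)}"

definition matches_decreasing :: "nat list \<Rightarrow> nat list" where
  "matches_decreasing n =
     decreasing (image_mset (matches n) (mset_set {\<pi>. \<pi> permutes {1..sum_list n}}))"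

lemma length_matches_decreasing: "length (matches_decreasing n) = fact (sum_list n)"
  by (simp add: matches_decreasing_def card_permutations)

end

theory Submission
  imports Defs
begin

text \<open>The letters \<open>t\<^sub>i(n)\<close> colour the positions \<open>1, \<dots>, d\<close>, and componentwise comparison of
  decreasing rearrangements says that for every threshold \<open>k\<close> there are at most as many
  permutations with at least \<open>k\<close> matches for \<open>n\<close> as for \<open>m\<close>. Such a tail count depends only on the
  colour class sizes. A majorized decreasing vector is turned into the majorizing one by unit
  transfers from an entry to one that is at least as large (\<open>tail_count_mono_majorization\<close>),
  so it suffices to
  recolour one point \<open>p\<close> from a class of size \<open>b \<le> a\<close> to a class \<open>A\<close> of size \<open>a\<close>
  (\<open>tail_count_transfer_le\<close>).

  Let \<open>C\<close> be the union of these two classes. Replacing \<open>\<pi>\<close> by \<open>\<beta>\<^sup>-\<^sup>1 \<circ> \<pi> \<circ> \<alpha>\<close> and averaging over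
  permutations \<open>\<alpha>\<close>, \<open>\<beta>\<close> of \<open>C\<close>, a permutation \<open>\<pi>\<close> enters only through \<open>C\<close> and \<open>D = \<pi>\<^sup>-\<^sup>1(C)\<close>: up to a
  constant, the number of matches is the number of points of \<open>C \<inter> D\<close> on which two uniformly random
  sets \<open>X \<subseteq> C - {p}\<close> and \<open>Y \<subseteq> D - {q}\<close> of size \<open>a\<close>, with random points \<open>p \<in> C\<close> and \<open>q \<in> D\<close>, agree.
  Recolouring replaces \<open>X\<close> and \<open>Y\<close> by \<open>X \<union> {p}\<close> and \<open>Y \<union> {q}\<close>.

  In terms of generating functions, pairs \<open>(X, Y)\<close> are counted by \<open>f\<^sup>r ((1 + x)(1 + y))\<^sup>t\<close> with
  \<open>f = z(1 + xy) + x + y\<close>, where \<open>r = |C \<inter> D|\<close>, \<open>t = |C - D| = |D - C|\<close> and \<open>z\<close> marks agreements. The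
  change caused by recolouring is \<open>z - 1\<close> times a combination, with nonnegative
  coefficients in \<open>z\<close>, of terms \<open>(xy - 1)\<close> times a product of \<open>r + t - 2\<close> factors \<open>f\<close> and
  \<open>(1 + x)(1 + y)\<close>. Division by \<open>z - 1\<close> corresponds to passing to tails, so what is needed is that the
  diagonal coefficients of such a product decrease beyond the middle. This holds because
  multiplication by \<open>1 + xy\<close> and by \<open>x + y\<close> preserves the property of being reflection symmetric and
  decreasing along diagonals beyond the middle (\<open>pair_sum_reflect\<close>,
  \<open>pair_sum_diagonal_antimono\<close>).\<close>

section \<open>Agreements of pairs of subsets\<close>

lemma sum_Pow_insert:
  fixes F :: "'a set \<Rightarrow> 'b::comm_monoid_add"
  assumes "finite C" "i \<notin> C"
  shows "(\<Sum>X\<in>Pow (insert i C). F X) = (\<Sum>X\<in>Pow C. F X + F (insert i X))"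
proof -
  have inj: "inj_on (insert i) (Pow C)"
    using assms(2) by (intro inj_onI) (metis Diff_insert_absorb PowD subsetD)
  have "(\<Sum>X\<in>Pow (insert i C). F X) = (\<Sum>X\<in>Pow C. F X) + (\<Sum>X\<in>insert i ` Pow C. F X)"
    unfolding Pow_insert using assms by (intro sum.union_disjoint) auto
  also have "(\<Sum>X\<in>insert i ` Pow C. F X) = (\<Sum>X\<in>Pow C. F (insert i X))"
    by (simp add: sum.reindex[OF inj])
  finally show ?thesis by (simp add: sum.distrib)
qed

text \<open>The number of common points of the ground sets \<open>C\<close> and \<open>D\<close> on which the indicators of \<open>X\<close> and
  \<open>Y\<close> coincide.\<close>
definition agreements :: "'a set \<Rightarrow> 'a set \<Rightarrow> 'a set \<Rightarrow> 'a set \<Rightarrow> nat" where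
  "agreements C D X Y = card {i \<in> C \<inter> D. i \<in> X \<longleftrightarrow> i \<in> Y}"

text \<open>The weighted number of pairs \<open>X \<subseteq> C\<close>, \<open>Y \<subseteq> D\<close> with \<open>|X| = a\<close> and \<open>|Y| = b\<close>, a pair with \<open>w\<close>
  agreements having weight \<open>\<psi> w\<close>. The sizes are integers so that the recursions below need no side
  conditions; out of range the sum is \<open>0\<close>.\<close>
definition pair_sum :: "'a set \<Rightarrow> 'a set \<Rightarrow> int \<Rightarrow> int \<Rightarrow> (nat \<Rightarrow> int) \<Rightarrow> int" where
  "pair_sum C D a b \<psi> = (\<Sum>X\<in>Pow C. \<Sum>Y\<in>Pow D.
     of_bool (int (card X) = a \<and> int (card Y) = b) * \<psi> (agreements C D X Y))"

lemma agreements_commute: "agreements C D X Y = agreements D C Y X"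
  unfolding agreements_def by (rule arg_cong[where f = card]) blast

lemma agreements_insert_both:
  assumes "finite C" "i \<notin> C"
  shows "agreements (insert i C) (insert i D) X Y =
    agreements C D X Y + of_bool (i \<in> X \<longleftrightarrow> i \<in> Y)"
proof -
  have "{j \<in> insert i C \<inter> insert i D. j \<in> X \<longleftrightarrow> j \<in> Y} =
    (if i \<in> X \<longleftrightarrow> i \<in> Y then insert i {j \<in> C \<inter> D. j \<in> X \<longleftrightarrow> j \<in> Y}
     else {j \<in> C \<inter> D. j \<in> X \<longleftrightarrow> j \<in> Y})"
    using assms by auto
  then show ?thesis using assms by (simp add: agreements_def)
qed

lemma agreements_insert_left_carrier:
  "i \<notin> D \<Longrightarrow> agreements (insert i C) D X Y = agreements C D X Y"
  unfolding agreements_def by (rule arg_cong[where f = card]) auto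

lemma agreements_insert_right_carrier:
  "i \<notin> C \<Longrightarrow> agreements C (insert i D) X Y = agreements C D X Y"
  unfolding agreements_def by (rule arg_cong[where f = card]) auto

lemma agreements_insert_left_set:
  "i \<notin> C \<inter> D \<Longrightarrow> agreements C D (insert i X) Y = agreements C D X Y"
  unfolding agreements_def by (rule arg_cong[where f = card]) auto

lemma agreements_insert_right_set:
  "i \<notin> C \<inter> D \<Longrightarrow> agreements C D X (insert i Y) = agreements C D X Y"
  unfolding agreements_def by (rule arg_cong[where f = card]) auto

lemmas agreements_simps = agreements_insert_both agreements_insert_left_carrier
  agreements_insert_right_carrier agreements_insert_left_set agreements_insert_right_set

lemma pair_sum_commute: "pair_sum C D a b \<psi> = pair_sum D C b a \<psi>"
  unfolding pair_sum_def
  by (subst sum.swap, intro sum.cong refl, subst agreements_commute) (simp add: conj_commute)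

text \<open>Multiplication of the generating function by \<open>z(1 + xy) + x + y\<close>; the factor \<open>z\<close> appears as a
  shift of \<open>\<psi>\<close>.\<close>
lemma pair_sum_insert_both:
  assumes "finite C" "finite D" "i \<notin> C" "i \<notin> D"
  shows "pair_sum (insert i C) (insert i D) a b \<psi> =
    pair_sum C D a b (\<lambda>w. \<psi> (Suc w)) + pair_sum C D (a - 1) (b - 1) (\<lambda>w. \<psi> (Suc w)) +
    pair_sum C D (a - 1) b \<psi> + pair_sum C D a (b - 1) \<psi>"
proof -
  have "pair_sum (insert i C) (insert i D) a b \<psi> =
    (\<Sum>X\<in>Pow C. \<Sum>Y\<in>Pow D.
      of_bool (int (card X) = a \<and> int (card Y) = b) * \<psi> (Suc (agreements C D X Y)) +
      of_bool (int (card X) = a - 1 \<and> int (card Y) = b - 1) * \<psi> (Suc (agreements C D X Y)) +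
      of_bool (int (card X) = a - 1 \<and> int (card Y) = b) * \<psi> (agreements C D X Y) +
      of_bool (int (card X) = a \<and> int (card Y) = b - 1) * \<psi> (agreements C D X Y))"
    unfolding pair_sum_def sum_Pow_insert[OF assms(1,3)] sum_Pow_insert[OF assms(2,4)]
      sum.distrib[symmetric]
  proof (intro sum.cong refl)
    fix X Y assume "X \<in> Pow C" "Y \<in> Pow D"
    then have XY: "i \<notin> X" "i \<notin> Y" "finite X" "finite Y"
      using assms by (auto intro: finite_subset)
    have eq: "(1 + int (card X) = a) = (int (card X) = a - 1)"
      "(1 + int (card Y) = b) = (int (card Y) = b - 1)" by auto
    show "of_bool (int (card X) = a \<and> int (card Y) = b) *
            \<psi> (agreements (insert i C) (insert i D) X Y) +
          of_bool (int (card X) = a \<and> int (card (insert i Y)) = b) *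
            \<psi> (agreements (insert i C) (insert i D) X (insert i Y)) +
          (of_bool (int (card (insert i X)) = a \<and> int (card Y) = b) *
            \<psi> (agreements (insert i C) (insert i D) (insert i X) Y) +
          of_bool (int (card (insert i X)) = a \<and> int (card (insert i Y)) = b) *
            \<psi> (agreements (insert i C) (insert i D) (insert i X) (insert i Y))) =
      of_bool (int (card X) = a \<and> int (card Y) = b) * \<psi> (Suc (agreements C D X Y)) +
      of_bool (int (card X) = a - 1 \<and> int (card Y) = b - 1) * \<psi> (Suc (agreements C D X Y)) +
      of_bool (int (card X) = a - 1 \<and> int (card Y) = b) * \<psi> (agreements C D X Y) +
      of_bool (int (card X) = a \<and> int (card Y) = b - 1) * \<psi> (agreements C D X Y)"
      using XY assms by (simp add: agreements_simps eq)
  qed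
  then show ?thesis
    by (simp add: pair_sum_def sum.distrib)
qed

lemma pair_sum_insert_left:
  assumes "finite C" "p \<notin> C" "p \<notin> D"
  shows "pair_sum (insert p C) D a b \<psi> = pair_sum C D a b \<psi> + pair_sum C D (a - 1) b \<psi>"
  unfolding pair_sum_def sum_Pow_insert[OF assms(1,2)] sum.distrib[symmetric]
proof (intro sum.cong refl)
  fix X Y assume "X \<in> Pow C" "Y \<in> Pow D"
  then have XY: "p \<notin> X" "finite X"
    using assms by (auto intro: finite_subset)
  have eq: "(1 + int (card X) = a) = (int (card X) = a - 1)" by auto
  show "of_bool (int (card X) = a \<and> int (card Y) = b) * \<psi> (agreements (insert p C) D X Y) +
    of_bool (int (card (insert p X)) = a \<and> int (card Y) = b) *
      \<psi> (agreements (insert p C) D (insert p X) Y) =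
    of_bool (int (card X) = a \<and> int (card Y) = b) * \<psi> (agreements C D X Y) +
    of_bool (int (card X) = a - 1 \<and> int (card Y) = b) * \<psi> (agreements C D X Y)"
    using XY assms by (simp add: agreements_simps eq)
qed

lemma pair_sum_insert_right:
  assumes "finite D" "q \<notin> D" "q \<notin> C"
  shows "pair_sum C (insert q D) a b \<psi> = pair_sum C D a b \<psi> + pair_sum C D a (b - 1) \<psi>"
  using pair_sum_insert_left[OF assms, of b a \<psi>] by (simp add: pair_sum_commute[of C])

text \<open>Multiplication of the generating function by
  \<open>(1 + x)(1 + y) = (1 + xy) + (x + y)\<close>.\<close>
lemma pair_sum_insert_exclusive:
  assumes "finite C" "finite D" "p \<notin> C" "p \<notin> D" "q \<notin> C" "q \<notin> D" "p \<noteq> q"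
  shows "pair_sum (insert p C) (insert q D) a b \<psi> =
    pair_sum C D a b \<psi> + pair_sum C D (a - 1) (b - 1) \<psi> +
    pair_sum C D (a - 1) b \<psi> + pair_sum C D a (b - 1) \<psi>"
  using assms by (simp add: pair_sum_insert_left pair_sum_insert_right)

text \<open>Two finite sets of equal size arise from the empty sets by adding common points and pairs of
  points that belong to only one of them.\<close>
lemma equal_card_induct [consumes 3, case_names empty shared exclusive]:
  fixes C D :: "'a set"
  assumes "finite C" "finite D" "card C = card D"
    and empty: "P {} {}"
    and shared: "\<And>i C D. finite C \<Longrightarrow> finite D \<Longrightarrow> card C = card D \<Longrightarrow> i \<notin> C \<Longrightarrow> i \<notin> D \<Longrightarrow>
      P C D \<Longrightarrow> P (insert i C) (insert i D)"
    and exclusive: "\<And>p q C D. finite C \<Longrightarrow> finite D \<Longrightarrow> card C = card D \<Longrightarrow>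
      p \<notin> C \<Longrightarrow> p \<notin> D \<Longrightarrow> q \<notin> C \<Longrightarrow> q \<notin> D \<Longrightarrow> p \<noteq> q \<Longrightarrow>
      P C D \<Longrightarrow> P (insert p C) (insert q D)"
  shows "P C D"
  using assms(1-3)
proof (induction "card C" arbitrary: C D)
  case 0
  then show ?case using empty by simp
next
  case (Suc n)
  show ?case
  proof (cases "C \<inter> D = {}")
    case False
    then obtain i where i: "i \<in> C" "i \<in> D" by blast
    have "P (insert i (C - {i})) (insert i (D - {i}))"
      by (rule shared) (use Suc i in auto)
    then show ?thesis using i by (simp add: insert_absorb)
  next
    case True
    obtain p q where pq: "p \<in> C" "q \<in> D"
      using Suc.hyps(2) Suc.prems by (metis card_eq_SucD insertI1)
    have "P (insert p (C - {p})) (insert q (D - {q}))"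
      by (rule exclusive) (use Suc pq True in auto)
    then show ?thesis using pq by (simp add: insert_absorb)
  qed
qed

text \<open>The reflection \<open>(a, b) \<mapsto> (|C| - b, |C| - a)\<close> maps every diagonal \<open>a - b = const\<close> to itself,
  which is what the next lemma uses. Complementation of \<open>X\<close> and \<open>Y\<close> alone only gives
  \<open>(|C| - a, |C| - b)\<close>.\<close>
lemma pair_sum_reflect:
  assumes "finite C" "finite D" "card C = card D"
  shows "pair_sum C D a b \<psi> = pair_sum C D (int (card C) - b) (int (card C) - a) \<psi>"
  using assms
proof (induction C D arbitrary: a b \<psi> rule: equal_card_induct)
  case empty
  show ?case by (auto simp: pair_sum_def)
next
  case (shared i C D)
  have s: "int (card (insert i C)) = int (card C) + 1"
    using shared.hyps by simp
  have e: "int (card C) + 1 - c = int (card C) - (c - 1)"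
    "int (card C) - (c - 1) - 1 = int (card C) - c" for c by simp_all
  show ?case
    unfolding pair_sum_insert_both[OF shared.hyps(1,2,4,5)] s e
    using shared.IH[of a b "\<lambda>w. \<psi> (Suc w)"] shared.IH[of "a - 1" "b - 1" "\<lambda>w. \<psi> (Suc w)"]
      shared.IH[of "a - 1" b \<psi>] shared.IH[of a "b - 1" \<psi>] by linarith
next
  case (exclusive p q C D)
  have s: "int (card (insert p C)) = int (card C) + 1"
    using exclusive.hyps by simp
  have e: "int (card C) + 1 - c = int (card C) - (c - 1)"
    "int (card C) - (c - 1) - 1 = int (card C) - c" for c by simp_all
  show ?case
    unfolding pair_sum_insert_exclusive[OF exclusive.hyps(1,2,4-8)] s e
    using exclusive.IH[of a b \<psi>] exclusive.IH[of "a - 1" "b - 1" \<psi>]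
      exclusive.IH[of "a - 1" b \<psi>] exclusive.IH[of a "b - 1" \<psi>] by linarith
qed

text \<open>In the induction step, the factor \<open>x + y\<close> lowers \<open>a + b\<close> by one while \<open>|C|\<close> has grown by one, so
  that the claim is inherited. The factor \<open>1 + xy\<close> requires a double step along the diagonal,
  which is either two
  applications of the hypothesis or, next to the middle, an instance of the reflection.\<close>
lemma pair_sum_diagonal_antimono:
  assumes "finite C" "finite D" "card C = card D" and "\<And>w. 0 \<le> \<psi> w"
    and "int (card C) + 1 \<le> a + b"
  shows "pair_sum C D a b \<psi> \<le> pair_sum C D (a - 1) (b - 1) \<psi>"
  using assms
proof (induction C D arbitrary: a b \<psi> rule: equal_card_induct)
  case empty
  then show ?case by (auto simp: pair_sum_def)
next
  case (shared i C D)
  have two: "pair_sum C D a b \<phi> \<le> pair_sum C D (a - 1 - 1) (b - 1 - 1) \<phi>"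
    if "\<And>w. 0 \<le> \<phi> w" for \<phi>
  proof (cases "a + b = int (card C) + 2")
    case True
    then have "a - 1 - 1 = int (card C) - b" "b - 1 - 1 = int (card C) - a" by auto
    then show ?thesis using pair_sum_reflect[OF shared.hyps(1-3), of a b \<phi>] by (simp only: order_refl)
  next
    case False
    then show ?thesis
      using shared.IH[of \<phi> a b, OF that] shared.IH[of \<phi> "a - 1" "b - 1", OF that]
        shared.prems(2) shared.hyps by simp
  qed
  have "pair_sum C D (a - 1) b \<psi> \<le> pair_sum C D (a - 1 - 1) (b - 1) \<psi>"
       "pair_sum C D a (b - 1) \<psi> \<le> pair_sum C D (a - 1) (b - 1 - 1) \<psi>"
    using shared.IH[of \<psi> "a - 1" b, OF shared.prems(1)] shared.IH[of \<psi> a "b - 1", OF shared.prems(1)]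
      shared.prems(2) shared.hyps by auto
  with two[of "\<lambda>w. \<psi> (Suc w)"] show ?case
    using shared.hyps shared.prems(1) by (simp add: pair_sum_insert_both)
next
  case (exclusive i j C D)
  have two: "pair_sum C D a b \<psi> \<le> pair_sum C D (a - 1 - 1) (b - 1 - 1) \<psi>"
  proof (cases "a + b = int (card C) + 2")
    case True
    then have "a - 1 - 1 = int (card C) - b" "b - 1 - 1 = int (card C) - a" by auto
    then show ?thesis
      using pair_sum_reflect[OF exclusive.hyps(1-3), of a b \<psi>] by (simp only: order_refl)
  next
    case False
    then show ?thesis
      using exclusive.IH[of \<psi> a b, OF exclusive.prems(1)]
        exclusive.IH[of \<psi> "a - 1" "b - 1", OF exclusive.prems(1)] exclusive.prems(2)
        exclusive.hyps by simp
  qed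
  have "pair_sum C D (a - 1) b \<psi> \<le> pair_sum C D (a - 1 - 1) (b - 1) \<psi>"
       "pair_sum C D a (b - 1) \<psi> \<le> pair_sum C D (a - 1) (b - 1 - 1) \<psi>"
    using exclusive.IH[of \<psi> "a - 1" b, OF exclusive.prems(1)]
      exclusive.IH[of \<psi> a "b - 1", OF exclusive.prems(1)] exclusive.prems(2) exclusive.hyps by auto
  with two show ?case
    using exclusive.hyps by (simp add: pair_sum_insert_exclusive)
qed

section \<open>Adding a point to both sets\<close>

text \<open>For fixed new points \<open>p\<close> and \<open>q\<close>, the total change of the weight when \<open>p\<close> is added to \<open>X\<close> and
  \<open>q\<close> to \<open>Y\<close>, over all \<open>X \<subseteq> C - {p}\<close> and \<open>Y \<subseteq> D - {q}\<close> of size \<open>a\<close>.\<close>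
definition exchange_gain :: "'a set \<Rightarrow> 'a set \<Rightarrow> int \<Rightarrow> (nat \<Rightarrow> int) \<Rightarrow> 'a \<Rightarrow> 'a \<Rightarrow> int" where
  "exchange_gain C D a \<psi> p q = (\<Sum>X\<in>Pow (C - {p}). \<Sum>Y\<in>Pow (D - {q}).
     of_bool (int (card X) = a \<and> int (card Y) = a) *
       (\<psi> (agreements C D (insert p X) (insert q Y)) - \<psi> (agreements C D X Y)))"

lemma exchange_gain_commute: "exchange_gain C D a \<psi> p q = exchange_gain D C a \<psi> q p"
  unfolding exchange_gain_def
  by (subst sum.swap, intro sum.cong refl)
    (simp add: conj_commute agreements_commute[of C D])

lemma exchange_gain_same: "exchange_gain C D a \<psi> i i = 0"
proof -
  have "agreements C D (insert i X) (insert i Y) = agreements C D X Y"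
    if "i \<notin> X" "i \<notin> Y" for X Y
    unfolding agreements_def by (rule arg_cong[where f = card]) (use that in auto)
  then show ?thesis unfolding exchange_gain_def
    by (intro sum.neutral ballI) (simp add: subset_Diff_insert)
qed

lemma exchange_gain_exclusive:
  assumes "p \<notin> D" "q \<notin> C"
  shows "exchange_gain C D a \<psi> p q = 0"
  using assms unfolding exchange_gain_def
  by (intro sum.neutral ballI) (simp add: agreements_simps)

text \<open>The points \<open>q\<close> (for \<open>X\<close>) and \<open>p\<close> (for \<open>Y\<close>) are still free. If exactly one of them is chosen,
  the number of agreements does not change; if both are chosen, it grows by two; if neither is, it
  drops by two.\<close>
lemma exchange_gain_shared:
  assumes "finite C" "finite D" "p \<notin> C" "p \<notin> D" "q \<notin> C" "q \<notin> D" "p \<noteq> q"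
  shows "exchange_gain (insert p (insert q C)) (insert p (insert q D)) a \<psi> p q =
    pair_sum C D (a - 1) (a - 1) (\<lambda>w. \<psi> (w + 2) - \<psi> w) -
    pair_sum C D a a (\<lambda>w. \<psi> (w + 2) - \<psi> w)"
proof -
  have d: "insert p (insert q C) - {p} = insert q C" "insert p (insert q D) - {q} = insert p D"
    using assms by auto
  show ?thesis
    unfolding exchange_gain_def d pair_sum_def sum_Pow_insert[OF assms(1,5)]
      sum_Pow_insert[OF assms(2,4)] sum.distrib[symmetric] sum_subtractf[symmetric]
  proof (intro sum.cong refl, goal_cases)
    case (1 X Y)
    then have XY: "p \<notin> X" "p \<notin> Y" "q \<notin> X" "q \<notin> Y" "finite X" "finite Y"
      using assms by (auto intro: finite_subset)
    have eq: "(1 + int (card X) = a) = (int (card X) = a - 1)"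
      "(1 + int (card Y) = a) = (int (card Y) = a - 1)" by auto
    show ?case
      using XY assms by (simp add: agreements_simps eq right_diff_distrib)
  qed
qed

lemma exchange_gain_half_shared:
  assumes "finite C" "finite D" "p \<notin> C" "p \<notin> D" "q \<notin> C" "q \<notin> D" "p \<noteq> q"
  shows "exchange_gain (insert p C) (insert p (insert q D)) a \<psi> p q =
    pair_sum C D a (a - 1) (\<lambda>w. \<psi> (w + 1) - \<psi> w) -
    pair_sum C D a a (\<lambda>w. \<psi> (w + 1) - \<psi> w)"
proof -
  have d: "insert p C - {p} = C" "insert p (insert q D) - {q} = insert p D"
    using assms by auto
  show ?thesis
    unfolding exchange_gain_def d pair_sum_def
      sum_Pow_insert[OF assms(2,4)] sum.distrib[symmetric] sum_subtractf[symmetric]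
  proof (intro sum.cong refl, goal_cases)
    case (1 X Y)
    then have XY: "p \<notin> X" "p \<notin> Y" "q \<notin> X" "q \<notin> Y" "finite X" "finite Y"
      using assms by (auto intro: finite_subset)
    have eq: "(1 + int (card X) = a) = (int (card X) = a - 1)"
      "(1 + int (card Y) = a) = (int (card Y) = a - 1)" by auto
    show ?case
      using XY assms by (simp add: agreements_simps eq right_diff_distrib)
  qed
qed

text \<open>Single terms with \<open>p \<in> C \<inter> D\<close> and \<open>q \<in> D - C\<close> can be negative. Their off-diagonal parts
  \<open>pair_sum C' D' a (a - 1)\<close> and \<open>pair_sum C' D' (a - 1) a\<close> cancel against those of the terms with the
  new points in \<open>C - D\<close> and \<open>C \<inter> D\<close>, after pairing \<open>C - D\<close> with \<open>D - C\<close> by a bijection.\<close>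
lemma sum_exchange_gain_nonneg:
  assumes "finite C" "finite D" "card C = card D" "mono \<psi>" "int (card C) \<le> 2 * a"
  shows "0 \<le> (\<Sum>p\<in>C. \<Sum>q\<in>D. exchange_gain C D a \<psi> p q)"
proof -
  define R P Q where "R = C \<inter> D" and "P = C - D" and "Q = D - C"
  let ?g = "exchange_gain C D a \<psi>"
  have fin: "finite R" "finite P" "finite Q" using assms by (auto simp: R_def P_def Q_def)
  have CD: "C = R \<union> P" "D = R \<union> Q" and disj: "R \<inter> P = {}" "R \<inter> Q = {}"
    by (auto simp: R_def P_def Q_def)
  have mono_le: "\<psi> w \<le> \<psi> (w + 1)" "\<psi> w \<le> \<psi> (w + 2)" for w
    using \<open>mono \<psi>\<close> by (simp_all add: monoD)
  have shared: "0 \<le> ?g p q" if "p \<in> R" "q \<in> R" for p q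
  proof (cases "p = q")
    case True
    then show ?thesis by (simp add: exchange_gain_same)
  next
    case False
    define C' D' where "C' = C - {p, q}" and "D' = D - {p, q}"
    have C: "C = insert p (insert q C')" and D: "D = insert p (insert q D')"
      using that by (auto simp: C'_def D'_def R_def)
    have f: "finite C'" "finite D'" "p \<notin> C'" "p \<notin> D'" "q \<notin> C'" "q \<notin> D'"
      using assms by (auto simp: C'_def D'_def)
    have card: "card C' = card D'" "int (card C') + 1 \<le> a + a"
      using assms(3,5) f False by (simp_all add: C D)
    have "pair_sum C' D' a a (\<lambda>w. \<psi> (w + 2) - \<psi> w) \<le>
        pair_sum C' D' (a - 1) (a - 1) (\<lambda>w. \<psi> (w + 2) - \<psi> w)"
      by (rule pair_sum_diagonal_antimono) (use f card mono_le in simp_all)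
    then show ?thesis
      unfolding C D using exchange_gain_shared[OF f False] by simp
  qed
  have half: "0 \<le> ?g i q + ?g p i" if "i \<in> R" "p \<in> P" "q \<in> Q" for i p q
  proof -
    define C' D' where "C' = C - {i, p}" and "D' = D - {i, q}"
    let ?\<theta> = "\<lambda>w. \<psi> (w + 1) - \<psi> w"
    have C: "C = insert i (insert p C')" and D: "D = insert i (insert q D')"
      using that by (auto simp: C'_def D'_def R_def P_def Q_def)
    have f: "finite C'" "finite D'" "i \<notin> C'" "i \<notin> D'" "p \<notin> C'" "p \<notin> D'" "q \<notin> C'" "q \<notin> D'"
      "i \<noteq> p" "i \<noteq> q" "p \<noteq> q"
      using assms that by (auto simp: C'_def D'_def R_def P_def Q_def)
    have card: "card C' = card D'" "int (card C') + 1 \<le> a + a"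
      using assms(3,5) f by (simp_all add: C D)
    have "?g i q = pair_sum (insert p C') D' a (a - 1) ?\<theta> - pair_sum (insert p C') D' a a ?\<theta>"
      unfolding C D by (rule exchange_gain_half_shared) (use f in auto)
    moreover have "?g p i =
        pair_sum (insert q D') C' a (a - 1) ?\<theta> - pair_sum (insert q D') C' a a ?\<theta>"
      unfolding C D exchange_gain_commute[of "insert i (insert p C')"]
      by (rule exchange_gain_half_shared) (use f in auto)
    ultimately have "?g i q + ?g p i =
        2 * (pair_sum C' D' (a - 1) (a - 1) ?\<theta> - pair_sum C' D' a a ?\<theta>)"
      using f by (simp add: pair_sum_insert_left pair_sum_commute[of D' C'])
    moreover have "pair_sum C' D' a a ?\<theta> \<le> pair_sum C' D' (a - 1) (a - 1) ?\<theta>"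
      by (rule pair_sum_diagonal_antimono) (use f card mono_le in simp_all)
    ultimately show ?thesis by simp
  qed
  have "card P = card Q"
    using assms(3) fin disj unfolding CD by (simp add: card_Un_disjoint)
  then obtain h where h: "bij_betw h P Q"
    using fin finite_same_card_bij by blast
  have cross: "0 \<le> (\<Sum>q\<in>Q. ?g i q) + (\<Sum>p\<in>P. ?g p i)" if "i \<in> R" for i
  proof -
    have "(\<Sum>q\<in>Q. ?g i q) = (\<Sum>p\<in>P. ?g i (h p))"
      using sum.reindex_bij_betw[OF h, of "?g i"] by simp
    then have "(\<Sum>q\<in>Q. ?g i q) + (\<Sum>p\<in>P. ?g p i) = (\<Sum>p\<in>P. ?g i (h p) + ?g p i)"
      by (simp add: sum.distrib)
    also have "0 \<le> \<dots>"
      by (intro sum_nonneg half) (use that h in \<open>auto simp: bij_betw_def\<close>)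
    finally show ?thesis .
  qed
  have excl: "(\<Sum>p\<in>P. \<Sum>q\<in>Q. ?g p q) = 0"
    by (intro sum.neutral ballI exchange_gain_exclusive) (auto simp: P_def Q_def)
  have split: "(\<Sum>q\<in>D. F q) = (\<Sum>q\<in>R. F q) + (\<Sum>q\<in>Q. F q)"
    "(\<Sum>q\<in>C. F q) = (\<Sum>q\<in>R. F q) + (\<Sum>q\<in>P. F q)" for F :: "'a \<Rightarrow> int"
    unfolding CD using fin disj by (simp_all add: sum.union_disjoint)
  have "(\<Sum>p\<in>C. \<Sum>q\<in>D. ?g p q) =
      (\<Sum>p\<in>R. \<Sum>q\<in>R. ?g p q) + (\<Sum>i\<in>R. (\<Sum>q\<in>Q. ?g i q) + (\<Sum>p\<in>P. ?g p i))"
    unfolding split sum.distrib excl by (simp add: sum.swap[of _ P R])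
  moreover have "0 \<le> (\<Sum>p\<in>R. \<Sum>q\<in>R. ?g p q)"
    by (intro sum_nonneg shared)
  moreover have "0 \<le> (\<Sum>i\<in>R. (\<Sum>q\<in>Q. ?g i q) + (\<Sum>p\<in>P. ?g p i))"
    by (intro sum_nonneg cross)
  ultimately show ?thesis by simp
qed

section \<open>Averaging over permutations of two colour classes\<close>

text \<open>Pairs of a point of \<open>C\<close> and a subset of \<open>C\<close> of size \<open>a\<close> that avoids the point.\<close>
definition pointed_subsets :: "'a set \<Rightarrow> nat \<Rightarrow> ('a \<times> 'a set) set" where
  "pointed_subsets C a = (SIGMA p:C. {X \<in> Pow (C - {p}). card X = a})"

lemma finite_pointed_subsets: "finite C \<Longrightarrow> finite (pointed_subsets C a)"
  unfolding pointed_subsets_def by (intro finite_SigmaI) auto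

lemma sum_pointed_subsets:
  fixes F :: "'a \<times> 'a set \<Rightarrow> int"
  assumes "finite C"
  shows "(\<Sum>f\<in>pointed_subsets C a. F f) =
    (\<Sum>p\<in>C. \<Sum>X\<in>Pow (C - {p}). of_bool (card X = a) * F (p, X))"
proof -
  have "(\<Sum>f\<in>pointed_subsets C a. F f) =
      (\<Sum>p\<in>C. \<Sum>X\<in>{X \<in> Pow (C - {p}). card X = a}. F (p, X))"
    unfolding pointed_subsets_def using assms by (subst sum.Sigma) (auto simp: split_def)
  also have "\<dots> = (\<Sum>p\<in>C. \<Sum>X\<in>Pow (C - {p}). of_bool (card X = a) * F (p, X))"
  proof (rule sum.cong[OF refl])
    fix p
    show "(\<Sum>X\<in>{X \<in> Pow (C - {p}). card X = a}. F (p, X)) =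
        (\<Sum>X\<in>Pow (C - {p}). of_bool (card X = a) * F (p, X))"
      using assms by (subst sum.inter_filter) (auto intro!: sum.cong simp del: sum_mult_of_bool_eq sum_of_bool_mult_eq)
  qed
  finally show ?thesis .
qed

lemma pointed_subsets_insert_le:
  assumes "finite C" "finite D" "card C = card D" "mono \<psi>" "card C \<le> 2 * a"
  shows "(\<Sum>f\<in>pointed_subsets C a. \<Sum>g\<in>pointed_subsets D a.
      \<psi> (agreements C D (snd f) (snd g)) :: int) \<le>
    (\<Sum>f\<in>pointed_subsets C a. \<Sum>g\<in>pointed_subsets D a.
      \<psi> (agreements C D (insert (fst f) (snd f)) (insert (fst g) (snd g))))"
proof -
  have "(\<Sum>f\<in>pointed_subsets C a. \<Sum>g\<in>pointed_subsets D a.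
      \<psi> (agreements C D (insert (fst f) (snd f)) (insert (fst g) (snd g))) -
      \<psi> (agreements C D (snd f) (snd g))) =
    (\<Sum>p\<in>C. \<Sum>X\<in>Pow (C - {p}). \<Sum>q\<in>D. \<Sum>Y\<in>Pow (D - {q}).
      of_bool (int (card X) = int a \<and> int (card Y) = int a) *
      (\<psi> (agreements C D (insert p X) (insert q Y)) - \<psi> (agreements C D X Y)))"
    by (simp only: sum_pointed_subsets assms(1,2) fst_conv snd_conv sum_distrib_left of_nat_eq_iff
      of_bool_conj mult.assoc)
  also have "\<dots> = (\<Sum>p\<in>C. \<Sum>q\<in>D. exchange_gain C D (int a) \<psi> p q)"
    unfolding exchange_gain_def by (intro sum.cong refl sum.swap)
  also have "0 \<le> \<dots>"
    by (rule sum_exchange_gain_nonneg) (use assms in simp_all)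
  finally show ?thesis by (simp add: sum_subtractf)
qed

lemma pointed_subsets_transitive:
  assumes "finite C" "(p, X) \<in> pointed_subsets C a" "(q, Y) \<in> pointed_subsets C a"
  obtains \<gamma> where "\<gamma> permutes C" "\<gamma> p = q" "\<gamma> ` X = Y"
proof -
  have pX: "p \<in> C" "X \<subseteq> C" "p \<notin> X" "card X = a" and qY: "q \<in> C" "Y \<subseteq> C" "q \<notin> Y" "card Y = a"
    using assms by (auto simp: pointed_subsets_def)
  have fin: "finite X" "finite Y" using pX qY assms(1) finite_subset by blast+
  obtain f where f: "bij_betw f X Y"
    using finite_same_card_bij[OF fin] pX qY by auto
  have "card (C - insert p X) = card (C - insert q Y)"
    using pX qY fin by (simp add: card_Diff_subset)
  then obtain g where g: "bij_betw g (C - insert p X) (C - insert q Y)"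
    using finite_same_card_bij[of "C - insert p X" "C - insert q Y"] assms(1) by auto
  define \<gamma> where
    "\<gamma> x = (if x = p then q else if x \<in> X then f x else if x \<in> C then g x else x)" for x
  have "bij_betw \<gamma> {p} {q}" by (simp add: \<gamma>_def)
  moreover have b: "bij_betw \<gamma> X Y"
    using f pX by (subst bij_betw_cong[of X \<gamma> f]) (auto simp: \<gamma>_def)
  ultimately have "bij_betw \<gamma> ({p} \<union> X) ({q} \<union> Y)"
    using qY by (intro bij_betw_combine) auto
  moreover have "bij_betw \<gamma> (C - insert p X) (C - insert q Y)"
    using g by (subst bij_betw_cong[of _ \<gamma> g]) (auto simp: \<gamma>_def)
  ultimately have "bij_betw \<gamma> (({p} \<union> X) \<union> (C - insert p X)) (({q} \<union> Y) \<union> (C - insert q Y))"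
    by (rule bij_betw_combine) auto
  moreover have "({p} \<union> X) \<union> (C - insert p X) = C" "({q} \<union> Y) \<union> (C - insert q Y) = C"
    using pX qY by auto
  ultimately have "bij_betw \<gamma> C C" by simp
  then have "\<gamma> permutes C"
    by (rule bij_imp_permutes) (use pX in \<open>auto simp: \<gamma>_def\<close>)
  moreover have "\<gamma> p = q" by (simp add: \<gamma>_def)
  moreover have "\<gamma> ` X = Y" using b by (simp add: bij_betw_def)
  ultimately show ?thesis using that by blast
qed

text \<open>By transitivity, a uniformly random permutation sends a fixed pointed subset to a uniformly
  random one. The constant \<open>K\<close> is the order of the stabilizer.\<close>
lemma sum_permutations_pointed_subset:
  assumes "finite C" "(p, X) \<in> pointed_subsets C a"
  obtains K :: int where "0 \<le> K"
    "\<And>F :: 'a \<times> 'a set \<Rightarrow> int.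
      (\<Sum>\<alpha>\<in>{\<alpha>. \<alpha> permutes C}. F (\<alpha> p, \<alpha> ` X)) = K * (\<Sum>f\<in>pointed_subsets C a. F f)"
proof
  let ?G = "{\<alpha>. \<alpha> permutes C}"
  let ?act = "\<lambda>\<alpha>. (\<alpha> p, \<alpha> ` X)"
  let ?fib = "\<lambda>f. {\<alpha> \<in> ?G. ?act \<alpha> = f}"
  show "0 \<le> int (card (?fib (p, X)))" by simp
  fix F :: "'a \<times> 'a set \<Rightarrow> int"
  have pX: "p \<in> C" "X \<subseteq> C" "p \<notin> X" "card X = a"
    using assms by (auto simp: pointed_subsets_def)
  have act: "?act ` ?G \<subseteq> pointed_subsets C a"
  proof (rule image_subsetI)
    fix \<alpha> assume "\<alpha> \<in> ?G"
    then have \<alpha>: "\<alpha> permutes C" by simp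
    then have "inj \<alpha>" by (rule permutes_inj)
    then have "card (\<alpha> ` X) = a" "\<alpha> p \<notin> \<alpha> ` X"
      using pX by (auto simp: card_image inj_on_subset[OF _ subset_UNIV] inj_image_mem_iff)
    moreover have "\<alpha> ` X \<subseteq> C"
      using pX permutes_in_image[OF \<alpha>] by auto
    ultimately show "?act \<alpha> \<in> pointed_subsets C a"
      using pX permutes_in_image[OF \<alpha>] by (simp add: pointed_subsets_def subset_Diff_insert)
  qed
  have fib: "card (?fib f) = card (?fib (p, X))" if f: "f \<in> pointed_subsets C a" for f
  proof -
    obtain q Y where qY: "f = (q, Y)" by (cases f)
    obtain \<gamma> where \<gamma>: "\<gamma> permutes C" "\<gamma> p = q" "\<gamma> ` X = Y"
      using pointed_subsets_transitive[OF assms] f qY by blast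
    have img: "(\<lambda>x. \<delta> (\<alpha> x)) ` Z = \<delta> ` \<alpha> ` Z" for \<delta> \<alpha> :: "'a \<Rightarrow> 'a" and Z
      by (rule image_image[symmetric])
    have "bij_betw ((\<circ>) \<gamma>) (?fib (p, X)) (?fib f)"
    proof (rule bij_betw_byWitness[where f' = "(\<circ>) (inv \<gamma>)"])
      show "\<forall>\<alpha>\<in>?fib (p, X). inv \<gamma> \<circ> (\<gamma> \<circ> \<alpha>) = \<alpha>"
        using permutes_inv_o[OF \<gamma>(1)] by (simp add: o_assoc)
      show "\<forall>\<alpha>\<in>?fib f. \<gamma> \<circ> (inv \<gamma> \<circ> \<alpha>) = \<alpha>"
        using permutes_inv_o[OF \<gamma>(1)] by (simp add: o_assoc)
      show "(\<circ>) \<gamma> ` ?fib (p, X) \<subseteq> ?fib f"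
        using \<gamma> qY by (intro image_subsetI) (simp add: permutes_compose img)
      have "inv \<gamma> q = p" "inv \<gamma> ` Y = X"
        using \<gamma> permutes_inverses(2)[OF \<gamma>(1)] by (auto simp: image_image)
      then show "(\<circ>) (inv \<gamma>) ` ?fib f \<subseteq> ?fib (p, X)"
        using \<gamma> qY by (intro image_subsetI) (simp add: permutes_compose permutes_inv img)
    qed
    then show ?thesis by (simp add: bij_betw_same_card)
  qed
  have "(\<Sum>\<alpha>\<in>?G. F (?act \<alpha>)) =
      (\<Sum>f\<in>pointed_subsets C a. of_nat (card (?fib f)) * F f)"
    by (rule sum_fun_comp) (use act assms finite_pointed_subsets finite_permutations in auto)
  also have "\<dots> = int (card (?fib (p, X))) * (\<Sum>f\<in>pointed_subsets C a. F f)"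
    unfolding sum_distrib_left by (intro sum.cong refl) (simp only: fib)
  finally show "(\<Sum>\<alpha>\<in>?G. F (?act \<alpha>)) = int (card (?fib (p, X))) * (\<Sum>f\<in>pointed_subsets C a. F f)" .
qed

lemma bij_betw_pointed_subsets:
  assumes "inj g"
  shows "bij_betw (\<lambda>(p, X). (g p, g ` X)) (pointed_subsets C a) (pointed_subsets (g ` C) a)"
proof (rule bij_betwI')
  fix f f' :: "'a \<times> 'a set"
  show "((case f of (p, X) \<Rightarrow> (g p, g ` X)) = (case f' of (p, X) \<Rightarrow> (g p, g ` X))) = (f = f')"
    using assms by (auto simp: inj_image_eq_iff inj_eq split: prod.splits)
next
  fix f assume "f \<in> pointed_subsets C a"
  then show "(case f of (p, X) \<Rightarrow> (g p, g ` X)) \<in> pointed_subsets (g ` C) a"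
    using assms by (auto simp: pointed_subsets_def card_image inj_on_subset[OF _ subset_UNIV]
      inj_image_mem_iff inj_eq)
next
  fix f assume "f \<in> pointed_subsets (g ` C) a"
  then obtain p Y where f: "f = (g p, Y)" "p \<in> C" "Y \<subseteq> g ` C - {g p}" "card Y = a"
    by (auto simp: pointed_subsets_def)
  then obtain X where X: "X \<subseteq> C" "Y = g ` X"
    by (metis Diff_subset order_trans subset_imageE)
  have "card X = a" using f(4) X assms by (simp add: card_image inj_on_subset[OF _ subset_UNIV])
  then show "\<exists>e\<in>pointed_subsets C a. f = (case e of (p, X) \<Rightarrow> (g p, g ` X))"
    using f X by (intro bexI[of _ "(p, X)"]) (auto simp: pointed_subsets_def)
qed

text \<open>The number of points of \<open>S\<close> that \<open>\<pi>\<close> maps to a point of the same colour, for a colouring \<open>c\<close>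
  of \<open>S\<close>.\<close>
definition color_matches :: "'a set \<Rightarrow> ('a \<Rightarrow> 'b) \<Rightarrow> ('a \<Rightarrow> 'a) \<Rightarrow> nat" where
  "color_matches S c \<pi> = card {x \<in> S. c x = c (\<pi> x)}"

text \<open>The number of permutations with at least \<open>k\<close> matches.\<close>
definition tail_count :: "'a set \<Rightarrow> ('a \<Rightarrow> 'b) \<Rightarrow> nat \<Rightarrow> nat" where
  "tail_count S c k = card {\<pi>. \<pi> permutes S \<and> k \<le> color_matches S c \<pi>}"

lemma color_matches_conj:
  assumes "\<alpha> permutes S" "\<pi> permutes S" "\<beta> permutes S"
  shows "color_matches S c (inv \<beta> \<circ> \<pi> \<circ> \<alpha>) = card {x \<in> S. c (inv \<alpha> x) = c (inv \<beta> (\<pi> x))}"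
proof -
  have "{x \<in> S. c (inv \<alpha> x) = c (inv \<beta> (\<pi> x))} = \<alpha> ` {x \<in> S. c x = c ((inv \<beta> \<circ> \<pi> \<circ> \<alpha>) x)}"
  proof (intro equalityI subsetI)
    fix x assume x: "x \<in> {x \<in> S. c (inv \<alpha> x) = c (inv \<beta> (\<pi> x))}"
    then have "inv \<alpha> x \<in> {x \<in> S. c x = c ((inv \<beta> \<circ> \<pi> \<circ> \<alpha>) x)}"
      using assms(1) permutes_in_image[OF permutes_inv[OF assms(1)]]
      by (simp add: permutes_inverses)
    then have "\<alpha> (inv \<alpha> x) \<in> \<alpha> ` {x \<in> S. c x = c ((inv \<beta> \<circ> \<pi> \<circ> \<alpha>) x)}"
      by (rule imageI)
    then show "x \<in> \<alpha> ` {x \<in> S. c x = c ((inv \<beta> \<circ> \<pi> \<circ> \<alpha>) x)}"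
      using assms(1) by (simp only: permutes_inverses)
  next
    fix x assume "x \<in> \<alpha> ` {x \<in> S. c x = c ((inv \<beta> \<circ> \<pi> \<circ> \<alpha>) x)}"
    then show "x \<in> {x \<in> S. c (inv \<alpha> x) = c (inv \<beta> (\<pi> x))}"
      using assms(1) by (auto simp: permutes_inverses permutes_in_image)
  qed
  then show ?thesis
    using permutes_inj[OF assms(1)]
    by (simp add: color_matches_def card_image inj_on_subset[OF _ subset_UNIV])
qed

lemma bij_betw_permutations_two_sided:
  assumes "\<alpha> permutes S" "\<beta> permutes S"
  shows "bij_betw (\<lambda>\<pi>. inv \<beta> \<circ> \<pi> \<circ> \<alpha>) {\<pi>. \<pi> permutes S} {\<pi>. \<pi> permutes S}"
proof (rule bij_betw_byWitness[where f' = "\<lambda>\<pi>. \<beta> \<circ> \<pi> \<circ> inv \<alpha>"])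
  note inv = permutes_inverses[OF assms(1)] permutes_inverses[OF assms(2)]
  show "\<forall>\<pi>\<in>{\<pi>. \<pi> permutes S}. \<beta> \<circ> (inv \<beta> \<circ> \<pi> \<circ> \<alpha>) \<circ> inv \<alpha> = \<pi>"
    "\<forall>\<pi>\<in>{\<pi>. \<pi> permutes S}. inv \<beta> \<circ> (\<beta> \<circ> \<pi> \<circ> inv \<alpha>) \<circ> \<alpha> = \<pi>"
    by (simp_all add: fun_eq_iff inv)
  show "(\<lambda>\<pi>. inv \<beta> \<circ> \<pi> \<circ> \<alpha>) ` {\<pi>. \<pi> permutes S} \<subseteq> {\<pi>. \<pi> permutes S}"
    "(\<lambda>\<pi>. \<beta> \<circ> \<pi> \<circ> inv \<alpha>) ` {\<pi>. \<pi> permutes S} \<subseteq> {\<pi>. \<pi> permutes S}"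
    using assms by (auto intro!: permutes_compose permutes_inv)
qed

lemma tail_count_average:
  assumes "finite S" "C \<subseteq> S"
  shows "int (card {\<alpha>. \<alpha> permutes C}) ^ 2 * int (tail_count S c k) =
    (\<Sum>\<pi>\<in>{\<pi>. \<pi> permutes S}. \<Sum>\<alpha>\<in>{\<alpha>. \<alpha> permutes C}. \<Sum>\<beta>\<in>{\<beta>. \<beta> permutes C}.
      of_bool (k \<le> card {x \<in> S. c (inv \<alpha> x) = c (inv \<beta> (\<pi> x))}))"
proof -
  let ?GS = "{\<pi>. \<pi> permutes S}" and ?GC = "{\<alpha>. \<alpha> permutes C}"
  let ?T = "\<lambda>\<pi> \<alpha> \<beta>. of_bool (k \<le> card {x \<in> S. c (inv \<alpha> x) = c (inv \<beta> (\<pi> x))}) :: int"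
  have fin: "finite ?GS" using assms by (simp add: finite_permutations)
  have tail: "int (tail_count S c k) = (\<Sum>\<pi>\<in>?GS. of_bool (k \<le> color_matches S c \<pi>))"
    using fin by (simp add: tail_count_def Collect_conj_eq)
  have "(\<Sum>\<pi>\<in>?GS. ?T \<pi> \<alpha> \<beta>) = int (tail_count S c k)" if "\<alpha> \<in> ?GC" "\<beta> \<in> ?GC" for \<alpha> \<beta>
  proof -
    have ab: "\<alpha> permutes S" "\<beta> permutes S"
      using that assms(2) by (auto intro: permutes_subset)
    have "(\<Sum>\<pi>\<in>?GS. ?T \<pi> \<alpha> \<beta>) =
        (\<Sum>\<pi>\<in>?GS. of_bool (k \<le> color_matches S c (inv \<beta> \<circ> \<pi> \<circ> \<alpha>)))"
      by (intro sum.cong refl) (use ab in \<open>simp add: color_matches_conj\<close>)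
    also have "\<dots> = int (tail_count S c k)"
      unfolding tail
      by (rule sum.reindex_bij_betw[OF bij_betw_permutations_two_sided[OF ab]])
    finally show ?thesis .
  qed
  then have "(\<Sum>\<alpha>\<in>?GC. \<Sum>\<beta>\<in>?GC. \<Sum>\<pi>\<in>?GS. ?T \<pi> \<alpha> \<beta>) = int (card ?GC) ^ 2 * int (tail_count S c k)"
    by (simp add: power2_eq_square)
  moreover have "(\<Sum>\<alpha>\<in>?GC. \<Sum>\<beta>\<in>?GC. \<Sum>\<pi>\<in>?GS. ?T \<pi> \<alpha> \<beta>) =
      (\<Sum>\<pi>\<in>?GS. \<Sum>\<alpha>\<in>?GC. \<Sum>\<beta>\<in>?GC. ?T \<pi> \<alpha> \<beta>)"
    by (simp only: sum.swap[of _ ?GS ?GC])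
  ultimately show ?thesis by simp
qed

text \<open>Let \<open>C\<close> be the union of the classes of the colours \<open>i\<close> and \<open>j\<close>, and \<open>A\<close> the class of \<open>i\<close>. A point
  \<open>x\<close> with exactly one of \<open>x\<close>, \<open>\<pi> x\<close> in \<open>C\<close> never matches; with neither in \<open>C\<close>, the match does not
  depend on \<open>\<alpha>\<close>, \<open>\<beta>\<close>.\<close>
lemma card_matches_as_agreements:
  assumes "finite S" "C \<subseteq> S" "\<pi> permutes S" "\<alpha> permutes C" "\<beta> permutes C"
    and classes: "\<And>x. x \<in> S \<Longrightarrow> x \<in> C \<longleftrightarrow> c x = i \<or> c x = j" and "i \<noteq> j"
    and A: "A = {x \<in> S. c x = i}"
  shows "card {x \<in> S. c (inv \<alpha> x) = c (inv \<beta> (\<pi> x))} =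
    card {x \<in> S - C. \<pi> x \<notin> C \<and> c x = c (\<pi> x)} +
    agreements C (inv \<pi> ` C) (\<alpha> ` A) (inv \<pi> ` \<beta> ` A)"
proof -
  let ?D = "inv \<pi> ` C"
  have D: "x \<in> ?D \<longleftrightarrow> \<pi> x \<in> C" for x
    using permutes_inverses[OF assms(3)] by (metis imageE imageI)
  have mem: "x \<in> \<delta> ` A \<longleftrightarrow> inv \<delta> x \<in> A" if "\<delta> permutes C" for x \<delta>
    using permutes_inverses[OF that] by (metis imageE imageI)
  have memD: "x \<in> inv \<pi> ` \<beta> ` A \<longleftrightarrow> inv \<beta> (\<pi> x) \<in> A" for x
    using permutes_inverses[OF assms(3)] mem[OF assms(5)] by (metis imageE imageI)
  have in_C: "inv \<delta> x \<in> C \<longleftrightarrow> x \<in> C" if "\<delta> permutes C" for x \<delta>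
    using permutes_in_image[OF permutes_inv[OF that]] .
  have out: "inv \<delta> x = x" if "\<delta> permutes C" "x \<notin> C" for x \<delta>
    using permutes_not_in[OF permutes_inv[OF that(1)] that(2)] .
  have \<pi>S: "\<pi> x \<in> S \<longleftrightarrow> x \<in> S" for x using permutes_in_image[OF assms(3)] .
  have eq: "c (inv \<alpha> x) = c (inv \<beta> (\<pi> x)) \<longleftrightarrow>
      (x \<notin> C \<and> \<pi> x \<notin> C \<and> c x = c (\<pi> x)) \<or>
      (x \<in> C \<and> \<pi> x \<in> C \<and> (inv \<alpha> x \<in> A \<longleftrightarrow> inv \<beta> (\<pi> x) \<in> A))" if "x \<in> S" for x
  proof -
    have S: "inv \<alpha> x \<in> S" "inv \<beta> (\<pi> x) \<in> S"
      using that \<pi>S permutes_in_image[OF permutes_inv[OF permutes_subset[OF assms(4,2)]]]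
        permutes_in_image[OF permutes_inv[OF permutes_subset[OF assms(5,2)]]] by simp_all
    show ?thesis
      using classes[OF S(1)] classes[OF S(2)] S in_C[OF assms(4), of x] in_C[OF assms(5), of "\<pi> x"]
        out[OF assms(4), of x] out[OF assms(5), of "\<pi> x"] \<open>i \<noteq> j\<close>
      unfolding A by (cases "x \<in> C"; cases "\<pi> x \<in> C"; simp; metis)
  qed
  have "{x \<in> S. c (inv \<alpha> x) = c (inv \<beta> (\<pi> x))} =
    {x \<in> S - C. \<pi> x \<notin> C \<and> c x = c (\<pi> x)} \<union>
    {x \<in> C \<inter> ?D. x \<in> \<alpha> ` A \<longleftrightarrow> x \<in> inv \<pi> ` \<beta> ` A}"
    using assms(2) by (auto simp: eq D mem[OF assms(4)] memD)
  moreover have "{x \<in> S - C. \<pi> x \<notin> C \<and> c x = c (\<pi> x)} \<inter>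
      {x \<in> C \<inter> ?D. x \<in> \<alpha> ` A \<longleftrightarrow> x \<in> inv \<pi> ` \<beta> ` A} = {}"
    by auto
  ultimately show ?thesis
    unfolding agreements_def using assms(1,2)
    by (simp add: card_Un_disjoint finite_subset)
qed

lemma tail_count_transfer_le:
  assumes "finite S" "p \<in> S" "c p = j" "i \<noteq> j"
    and larger: "card {x \<in> S. c x = j} \<le> card {x \<in> S. c x = i}"
  shows "tail_count S c k \<le> tail_count S (c(p := i)) k"
proof -
  define A where "A = {x \<in> S. c x = i}"
  define C where "C = {x \<in> S. c x = i \<or> c x = j}"
  define a where "a = card A"
  let ?c' = "c(p := i)"
  let ?GS = "{\<pi>. \<pi> permutes S}" and ?GC = "{\<alpha>. \<alpha> permutes C}"
  have CS: "C \<subseteq> S" "finite C" "A \<subseteq> C" "p \<in> C" "p \<notin> A"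
    using assms by (auto simp: C_def A_def)
  have "C = A \<union> {x \<in> S. c x = j}" "A \<inter> {x \<in> S. c x = j} = {}"
    using assms(4) by (auto simp: C_def A_def)
  then have cardC: "card C \<le> 2 * a"
    using larger assms(1) by (simp add: card_Un_disjoint a_def A_def)
  have pA: "(p, A) \<in> pointed_subsets C a"
    using CS by (auto simp: pointed_subsets_def a_def)
  obtain K :: int where K: "0 \<le> K" "\<And>F :: 'a \<times> 'a set \<Rightarrow> int.
      (\<Sum>\<alpha>\<in>?GC. F (\<alpha> p, \<alpha> ` A)) = K * (\<Sum>f\<in>pointed_subsets C a. F f)"
    by (rule sum_permutations_pointed_subset[OF CS(2) pA]) (rule that)
  have "(\<Sum>\<alpha>\<in>?GC. \<Sum>\<beta>\<in>?GC. of_bool (k \<le> card {x \<in> S. c (inv \<alpha> x) = c (inv \<beta> (\<pi> x))})) \<le>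
    (\<Sum>\<alpha>\<in>?GC. \<Sum>\<beta>\<in>?GC. of_bool (k \<le> card {x \<in> S. ?c' (inv \<alpha> x) = ?c' (inv \<beta> (\<pi> x))}) :: int)"
    if "\<pi> \<in> ?GS" for \<pi>
  proof -
    have \<pi>: "\<pi> permutes S" using that by simp
    define D where "D = inv \<pi> ` C"
    define K0 where "K0 = card {x \<in> S - C. \<pi> x \<notin> C \<and> c x = c (\<pi> x)}"
    have inj: "inj (inv \<pi>)" by (rule permutes_inj[OF permutes_inv[OF \<pi>]])
    define \<psi> :: "nat \<Rightarrow> int" where "\<psi> w = of_bool (k \<le> K0 + w)" for w
    \<comment> \<open>the images of \<open>(p, A)\<close> under \<open>\<alpha>\<close> and under \<open>\<pi>\<^sup>-\<^sup>1 \<circ> \<beta>\<close> are independent and uniform\<close>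
    have average: "(\<Sum>\<alpha>\<in>?GC. \<Sum>\<beta>\<in>?GC. F (\<alpha> p, \<alpha> ` A) (inv \<pi> (\<beta> p), inv \<pi> ` \<beta> ` A)) =
        K * K * (\<Sum>f\<in>pointed_subsets C a. \<Sum>g\<in>pointed_subsets D a. F f g)"
      for F :: "'a \<times> 'a set \<Rightarrow> 'a \<times> 'a set \<Rightarrow> int"
    proof -
      have "(\<Sum>\<beta>\<in>?GC. F f (inv \<pi> (\<beta> p), inv \<pi> ` \<beta> ` A)) = K * (\<Sum>g\<in>pointed_subsets D a. F f g)" for f
        using K(2)[of "\<lambda>(q, Y). F f (inv \<pi> q, inv \<pi> ` Y)"]
          sum.reindex_bij_betw[OF bij_betw_pointed_subsets[OF inj, of C a], of "F f"]
        by (simp add: D_def split_def)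
      then show ?thesis
        using K(2)[of "\<lambda>f. K * (\<Sum>g\<in>pointed_subsets D a. F f g)"]
        by (simp add: sum_distrib_left[symmetric] mult.assoc)
    qed
    \<comment> \<open>before and after recolouring \<open>p\<close>, the class of \<open>i\<close> is \<open>A\<close> and \<open>insert p A\<close>, while \<open>C\<close> is the same\<close>
    have before: "card {x \<in> S. c (inv \<alpha> x) = c (inv \<beta> (\<pi> x))} =
        K0 + agreements C D (\<alpha> ` A) (inv \<pi> ` \<beta> ` A)" if "\<alpha> permutes C" "\<beta> permutes C" for \<alpha> \<beta>
      unfolding K0_def D_def
      by (rule card_matches_as_agreements[OF assms(1) CS(1) \<pi> that _ assms(4)])
        (auto simp: C_def A_def)
    have A': "insert p A = {x \<in> S. ?c' x = i}"
      using assms(2) by (auto simp: A_def)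
    have "{x \<in> S - C. \<pi> x \<notin> C \<and> ?c' x = ?c' (\<pi> x)} = {x \<in> S - C. \<pi> x \<notin> C \<and> c x = c (\<pi> x)}"
      using CS(4) by auto
    then have K0': "K0 = card {x \<in> S - C. \<pi> x \<notin> C \<and> ?c' x = ?c' (\<pi> x)}"
      by (simp add: K0_def)
    have after: "card {x \<in> S. ?c' (inv \<alpha> x) = ?c' (inv \<beta> (\<pi> x))} =
        K0 + agreements C D (insert (\<alpha> p) (\<alpha> ` A)) (insert (inv \<pi> (\<beta> p)) (inv \<pi> ` \<beta> ` A))"
      if "\<alpha> permutes C" "\<beta> permutes C" for \<alpha> \<beta>
      unfolding K0' D_def image_insert[symmetric]
      by (rule card_matches_as_agreements[OF assms(1) CS(1) \<pi> that _ assms(4) A'])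
        (use assms(3) in \<open>auto simp: C_def\<close>)
    have "(\<Sum>f\<in>pointed_subsets C a. \<Sum>g\<in>pointed_subsets D a. \<psi> (agreements C D (snd f) (snd g))) \<le>
      (\<Sum>f\<in>pointed_subsets C a. \<Sum>g\<in>pointed_subsets D a.
        \<psi> (agreements C D (insert (fst f) (snd f)) (insert (fst g) (snd g))))"
    proof (rule pointed_subsets_insert_le)
      show "mono \<psi>" by (rule monoI) (simp add: \<psi>_def)
      show "card C = card D"
        using inj by (simp add: D_def card_image inj_on_subset[OF _ subset_UNIV])
    qed (use CS(2) cardC in \<open>simp_all add: D_def\<close>)
    from mult_left_mono[OF this, of "K * K"]
    show ?thesis
      using average[of "\<lambda>f g. \<psi> (agreements C D (snd f) (snd g))"]
        average[of "\<lambda>f g. \<psi> (agreements C D (insert (fst f) (snd f)) (insert (fst g) (snd g)))"]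
      by (simp add: before after \<psi>_def del: fun_upd_apply)
  qed
  then have "int (card ?GC) ^ 2 * int (tail_count S c k) \<le> int (card ?GC) ^ 2 * int (tail_count S ?c' k)"
    unfolding tail_count_average[OF assms(1) CS(1)] by (rule sum_mono)
  moreover have "card ?GC > 0"
    using CS(2) by (simp add: card_permutations)
  ultimately show ?thesis by simp
qed

lemma tail_count_permute:
  assumes "finite S" "\<gamma> permutes S"
  shows "tail_count S (c \<circ> \<gamma>) k = tail_count S c k"
proof -
  have "color_matches S (c \<circ> \<gamma>) \<pi> = color_matches S c (inv (inv \<gamma>) \<circ> \<pi> \<circ> inv \<gamma>)"
    if "\<pi> permutes S" for \<pi>
    using color_matches_conj[OF permutes_inv[OF assms(2)] that permutes_inv[OF assms(2)], of c]
      assms(2) by (simp add: color_matches_def permutes_inv_inv)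
  then have "{\<pi>. \<pi> permutes S \<and> k \<le> color_matches S (c \<circ> \<gamma>) \<pi>} =
      {\<pi> \<in> {\<pi>. \<pi> permutes S}. k \<le> color_matches S c (inv (inv \<gamma>) \<circ> \<pi> \<circ> inv \<gamma>)}"
    by auto
  also have "card \<dots> = card {\<pi> \<in> {\<pi>. \<pi> permutes S}. k \<le> color_matches S c \<pi>}"
  proof (rule bij_betw_same_card)
    show "bij_betw (\<lambda>\<pi>. inv (inv \<gamma>) \<circ> \<pi> \<circ> inv \<gamma>)
      {\<pi> \<in> {\<pi>. \<pi> permutes S}. k \<le> color_matches S c (inv (inv \<gamma>) \<circ> \<pi> \<circ> inv \<gamma>)}
      {\<pi> \<in> {\<pi>. \<pi> permutes S}. k \<le> color_matches S c \<pi>}"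
      using bij_betw_permutations_two_sided[OF permutes_inv[OF assms(2)] permutes_inv[OF assms(2)]]
      by (auto simp: bij_betw_def inj_on_def)
  qed
  finally show ?thesis by (simp add: tail_count_def)
qed

lemma tail_count_cong_class_sizes:
  assumes "finite S"
    and "\<And>i. card {x \<in> S. c x = i} = card {x \<in> S. c' x = i}"
  shows "tail_count S c k = tail_count S c' k"
proof -
  have "image_mset c (mset_set S) = image_mset c' (mset_set S)"
  proof (rule multiset_eqI)
    fix i
    have "count (image_mset b (mset_set S)) i = card {x \<in> S. b x = i}" for b :: "'a \<Rightarrow> 'b"
      using assms(1) by (simp add: count_image_mset vimage_def Collect_conj_eq Int_commute)
    then show "count (image_mset c (mset_set S)) i = count (image_mset c' (mset_set S)) i"
      using assms(2) by simp
  qed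
  then obtain \<gamma> where \<gamma>: "\<gamma> permutes S" "\<forall>x\<in>S. c x = c' (\<gamma> x)"
    using image_mset_eq_implies_permutes[OF assms(1)] by blast
  have "color_matches S c \<pi> = color_matches S (c' \<circ> \<gamma>) \<pi>" if "\<pi> permutes S" for \<pi>
    unfolding color_matches_def
    by (rule arg_cong[where f = card]) (use \<gamma>(2) permutes_in_image[OF that] in auto)
  then have "tail_count S c k = tail_count S (c' \<circ> \<gamma>) k"
    unfolding tail_count_def by (metis (mono_tags, lifting) Collect_cong)
  then show ?thesis using tail_count_permute[OF assms(1) \<gamma>(1)] by simp
qed

section \<open>Majorization as a chain of unit transfers\<close>

text \<open>The induction is on the total gap between the partial sums of the class sizes \<open>f\<close> and \<open>g\<close>. One
  unit is moved to the first index \<open>i\<close> where the two differ from the last index \<open>j\<close> before the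
  partial sums coincide again. This choice keeps \<open>f\<close> decreasing and its partial sums below those
  of \<open>g\<close>.\<close>
lemma tail_count_mono_majorization:
  fixes f g :: "nat \<Rightarrow> nat" and c c' :: "'a \<Rightarrow> nat"
  assumes "finite S"
    and f_dec: "\<And>a b. a \<le> b \<Longrightarrow> b < q \<Longrightarrow> f b \<le> f a"
    and g_dec: "\<And>a b. a \<le> b \<Longrightarrow> b < q \<Longrightarrow> g b \<le> g a"
    and le: "\<And>l. l \<le> q \<Longrightarrow> (\<Sum>i<l. f i) \<le> (\<Sum>i<l. g i)"
    and total: "(\<Sum>i<q. f i) = (\<Sum>i<q. g i)"
    and c: "c ` S \<subseteq> {..<q}" "\<And>i. i < q \<Longrightarrow> card {x \<in> S. c x = i} = f i"
    and c': "c' ` S \<subseteq> {..<q}" "\<And>i. i < q \<Longrightarrow> card {x \<in> S. c' x = i} = g i"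
  shows "tail_count S c k \<le> tail_count S c' k"
  using f_dec le total c
proof (induction "\<Sum>l\<le>q. (\<Sum>i<l. g i) - (\<Sum>i<l. f i)" arbitrary: f c rule: less_induct)
  case less
  note f_dec = less.prems(1) and le = less.prems(2) and total = less.prems(3) and c = less.prems(4,5)
  let ?F = "\<lambda>l. \<Sum>i<l. f i" and ?G = "\<lambda>l. \<Sum>i<l. g i"
  show ?case
  proof (cases "\<forall>i<q. f i = g i")
    case True
    have "card {x \<in> S. c x = i} = card {x \<in> S. c' x = i}" for i
    proof (cases "i < q")
      case False
      then have "{x \<in> S. c x = i} = {}" "{x \<in> S. c' x = i} = {}"
        using c(1) c'(1) by auto
      then show ?thesis by (simp only: card.empty)
    qed (use True c(2) c'(2) in simp)
    then show ?thesis
      by (intro eq_refl tail_count_cong_class_sizes[OF assms(1)])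
  next
    case False
    define i where "i = (LEAST i. i < q \<and> f i \<noteq> g i)"
    have i: "i < q" "f i \<noteq> g i"
      using LeastI_ex[of "\<lambda>i. i < q \<and> f i \<noteq> g i"] False by (auto simp: i_def)
    have before_i: "f a = g a" if "a < i" for a
      using not_less_Least[of a "\<lambda>i. i < q \<and> f i \<noteq> g i"] that i(1) by (auto simp: i_def)
    have "?F i = ?G i" by (rule sum.cong) (auto simp: before_i)
    then have fi: "f i < g i"
      using le[of "Suc i"] i by simp
    then have Fi: "?F (Suc i) < ?G (Suc i)" using \<open>?F i = ?G i\<close> by simp
    define t where "t = (LEAST t. i < t \<and> ?F t = ?G t)"
    have t: "i < t" "?F t = ?G t" "t \<le> q"
      using LeastI[of "\<lambda>t. i < t \<and> ?F t = ?G t" q] Least_le[of "\<lambda>t. i < t \<and> ?F t = ?G t" q] i total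
      by (auto simp: t_def)
    have gap: "?F l < ?G l" if "i < l" "l < t" for l
      using not_less_Least[of l "\<lambda>t. i < t \<and> ?F t = ?G t"] le[of l] that t(3)
      by (auto simp: t_def)
    obtain j where j: "t = Suc j" "i < j" "j < q"
      using t Fi by (cases t) (auto simp: less_Suc_eq)
    have fj: "g j < f j"
      using gap[of j] t(2) j by simp
    define f' where "f' = f(i := f i + 1, j := f j - 1)"
    \<comment> \<open>exactly the partial sums of length \<open>l\<close> with \<open>i < l \<le> j\<close> grow by one\<close>
    have F': "(\<Sum>x<l. f' x) + of_bool (j < l) = ?F l + of_bool (i < l)" for l
      using j(2) fj by (induction l) (auto simp: f'_def less_Suc_eq)
    obtain p where p: "p \<in> S" "c p = j"
    proof -
      have "{x \<in> S. c x = j} \<noteq> {}"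
        using c(2)[of j] j fj by (metis card.empty not_less_zero)
      then show ?thesis using that by auto
    qed
    have "tail_count S c k \<le> tail_count S (c(p := i)) k"
      by (rule tail_count_transfer_le[where j = j]) (use assms(1) p c(2) i j f_dec[of i j] in auto)
    also have "\<dots> \<le> tail_count S c' k"
    proof (rule less.hyps)
      have F'_le: "(\<Sum>x<l. f' x) \<le> ?G l" if "l \<le> q" for l
        using F'[of l] le[OF that] gap[of l] j by (cases "i < l"; cases "j < l") auto
      then show "(\<Sum>x<l. f' x) \<le> ?G l" if "l \<le> q" for l using that .
      have F'_ge: "?F l \<le> (\<Sum>x<l. f' x)" for l
        using F'[of l] j(2) by (cases "i < l"; cases "j < l") auto
      show "(\<Sum>l\<le>q. ?G l - (\<Sum>x<l. f' x)) < (\<Sum>l\<le>q. ?G l - ?F l)"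
      proof (rule sum_strict_mono_ex1)
        show "\<forall>l\<in>{..q}. ?G l - (\<Sum>x<l. f' x) \<le> ?G l - ?F l"
          using F'_ge by (simp add: diff_le_mono2)
        have "?G (Suc i) - (\<Sum>x<Suc i. f' x) < ?G (Suc i) - ?F (Suc i)"
          using F'[of "Suc i"] Fi j(2) by simp
        then show "\<exists>l\<in>{..q}. ?G l - (\<Sum>x<l. f' x) < ?G l - ?F l"
          using i(1) by (intro bexI[of _ "Suc i"]) auto
      qed simp
      show "(\<Sum>x<q. f' x) = (\<Sum>x<q. g x)"
        using F'[of q] i(1) j(3) total by simp
      show "c(p := i) ` S \<subseteq> {..<q}" using c(1) i(1) by auto
      show "card {x \<in> S. (c(p := i)) x = b} = f' b" if "b < q" for b
      proof -
        consider "b = i" | "b = j" | "b \<noteq> i" "b \<noteq> j" by blast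
        then show ?thesis
        proof cases
          case 1
          then have "{x \<in> S. (c(p := i)) x = b} = insert p {x \<in> S. c x = i}"
            using p by auto
          then show ?thesis using 1 c(2)[OF i(1)] p j(2) assms(1) by (simp add: f'_def)
        next
          case 2
          then have "{x \<in> S. (c(p := i)) x = b} = {x \<in> S. c x = j} - {p}"
            using j(2) by auto
          then show ?thesis using 2 c(2)[OF j(3)] p assms(1) by (simp add: f'_def)
        next
          case 3
          then have "{x \<in> S. (c(p := i)) x = b} = {x \<in> S. c x = b}"
            using p by auto
          then show ?thesis using 3 c(2)[OF that] by (simp add: f'_def)
        qed
      qed
      show "f' b \<le> f' a" if ab: "a \<le> b" "b < q" for a b
      proof -
        have fba: "f b \<le> f a" using f_dec ab .
        consider "b = i" "a < i" | "a = j" "j < b" | "a = b" | "b \<noteq> i" "a \<noteq> j"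
          using ab(1) j(2) by linarith
        then show ?thesis
        proof cases
          case 1
          then have "f a = g a" "g i \<le> g a" using before_i g_dec[of a i] i(1) by auto
          then show ?thesis using 1 fi j(2) by (simp add: f'_def)
        next
          case 2
          then have "?F (Suc (Suc j)) \<le> ?G (Suc (Suc j))" using le[of "Suc (Suc j)"] ab by simp
          then have "f (Suc j) \<le> g (Suc j)" using t(2) j(1) by simp
          moreover have "f b \<le> f (Suc j)" using f_dec[of "Suc j" b] 2 ab by simp
          moreover have "g (Suc j) \<le> g j" using g_dec[of j "Suc j"] 2 ab by simp
          ultimately show ?thesis using 2 fj j(2) by (simp add: f'_def)
        qed (use fba in \<open>auto simp: f'_def\<close>)
      qed
    qed
    finally show ?thesis .
  qed
qed

section \<open>Decreasing rearrangements and canonical words\<close>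

lemma nth_le_if_tails_le:
  fixes xs ys :: "'a::linorder list"
  assumes "sorted_wrt (\<ge>) xs" "sorted_wrt (\<ge>) ys" "length xs = length ys"
    and tails: "\<And>k. length (filter (\<lambda>x. k \<le> x) xs) \<le> length (filter (\<lambda>x. k \<le> x) ys)"
    and "j < length xs"
  shows "xs ! j \<le> ys ! j"
proof (rule ccontr)
  assume "\<not> xs ! j \<le> ys ! j"
  then have less: "ys ! j < xs ! j" by simp
  have "{..j} \<subseteq> {i. i < length xs \<and> xs ! j \<le> xs ! i}"
  proof
    fix i assume "i \<in> {..j}"
    then show "i \<in> {i. i < length xs \<and> xs ! j \<le> xs ! i}"
      using assms(1,5) by (cases "i = j") (auto simp: sorted_wrt_iff_nth_less)
  qed
  from card_mono[OF _ this] have "Suc j \<le> length (filter (\<lambda>x. xs ! j \<le> x) xs)"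
    by (simp add: length_filter_conv_card)
  moreover have "{i. i < length ys \<and> xs ! j \<le> ys ! i} \<subseteq> {..<j}"
  proof
    fix i assume i: "i \<in> {i. i < length ys \<and> xs ! j \<le> ys ! i}"
    show "i \<in> {..<j}"
    proof (rule ccontr)
      assume "i \<notin> {..<j}"
      then have "ys ! i \<le> ys ! j"
        using i assms(2) by (cases "i = j") (auto simp: sorted_wrt_iff_nth_less)
      then show False using i less by auto
    qed
  qed
  from card_mono[OF _ this] have "length (filter (\<lambda>x. xs ! j \<le> x) ys) \<le> j"
    by (simp add: length_filter_conv_card)
  ultimately show False using tails[of "xs ! j"] by simp
qed

lemma count_list_concat_replicate:
  "distinct ks \<Longrightarrow> count_list (concat (map (\<lambda>k. replicate (g k) k) ks)) x =
    (if x \<in> set ks then g x else 0)"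
proof (induction ks)
  case (Cons k ks)
  have "count_list (replicate b k) x = (if x = k then b else 0)" for b
    by (induction b) auto
  then show ?case using Cons by auto
qed simp

lemma card_letter_class:
  "card {x \<in> {1..sum_list n}. letter n x = k} = (if k \<in> {1..length n} then n ! (k - 1) else 0)"
proof -
  let ?w = "canonical_word n"
  have "{x \<in> {1..sum_list n}. letter n x = k} = Suc ` {i. i < length ?w \<and> k = ?w ! i}"
  proof (intro equalityI subsetI)
    fix x assume "x \<in> {x \<in> {1..sum_list n}. letter n x = k}"
    then show "x \<in> Suc ` {i. i < length ?w \<and> k = ?w ! i}"
      by (intro image_eqI[of _ _ "x - 1"]) (auto simp: letter_def length_canonical_word)
  qed (auto simp: letter_def length_canonical_word)
  then have "card {x \<in> {1..sum_list n}. letter n x = k} = count_list ?w k"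
    by (simp add: card_image count_list_eq_length_filter length_filter_conv_card)
  then show ?thesis
    unfolding canonical_word_def
    by (simp add: count_list_concat_replicate atLeastLessThanSuc_atLeastAtMost del: upt_Suc)
qed

lemma letter_mem:
  assumes "x \<in> {1..sum_list n}"
  shows "letter n x \<in> {1..length n}"
proof (rule ccontr)
  assume "letter n x \<notin> {1..length n}"
  then have "card {y \<in> {1..sum_list n}. letter n y = letter n x} = 0"
    by (simp only: card_letter_class if_False)
  then show False using assms by auto
qed

text \<open>Renaming the letters turns the canonical word into a colouring by \<open>{..<length n}\<close> with decreasing
  class sizes and the same matches.\<close>
lemma decreasing_coloring:
  obtains c :: "nat \<Rightarrow> nat" where
    "c ` {1..sum_list n} \<subseteq> {..<length n}"
    "\<And>i. i < length n \<Longrightarrow> card {x \<in> {1..sum_list n}. c x = i} = decreasing (mset n) ! i"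
    "\<And>\<pi>. \<pi> permutes {1..sum_list n} \<Longrightarrow> color_matches {1..sum_list n} c \<pi> = matches n \<pi>"
proof -
  let ?S = "{1..sum_list n}"
  obtain \<rho> where \<rho>: "\<rho> permutes {..<length n}" "permute_list \<rho> n = decreasing (mset n)"
    using mset_eq_permutation[of "decreasing (mset n)" n] by auto
  define c where "c x = inv \<rho> (letter n x - 1)" for x
  have c_eq: "c x = i \<longleftrightarrow> letter n x = Suc (\<rho> i)" if "x \<in> ?S" for x i
  proof -
    have "c x = i \<longleftrightarrow> letter n x - 1 = \<rho> i"
      unfolding c_def using permutes_inverses[OF \<rho>(1)] by metis
    then show ?thesis using letter_mem[OF that] by auto
  qed
  show thesis
  proof (rule that[of c])
    show "c ` ?S \<subseteq> {..<length n}"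
    proof (rule image_subsetI)
      fix x assume "x \<in> ?S"
      then have "letter n x - 1 \<in> {..<length n}" using letter_mem by fastforce
      then show "c x \<in> {..<length n}"
        unfolding c_def using permutes_in_image[OF permutes_inv[OF \<rho>(1)]] by blast
    qed
    show "card {x \<in> ?S. c x = i} = decreasing (mset n) ! i" if "i < length n" for i
    proof -
      have "{x \<in> ?S. c x = i} = {x \<in> ?S. letter n x = Suc (\<rho> i)}"
        using c_eq by auto
      moreover have "\<rho> i < length n" using permutes_in_image[OF \<rho>(1)] that by blast
      ultimately have "card {x \<in> ?S. c x = i} = n ! \<rho> i"
        using card_letter_class[of n "Suc (\<rho> i)"] by (simp only:) simp
      then show ?thesis
        using \<rho> that by (simp flip: \<rho>(2) add: permute_list_nth)
    qed
    show "color_matches ?S c \<pi> = matches n \<pi>" if "\<pi> permutes ?S" for \<pi>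
    proof -
      have "c x = c (\<pi> x) \<longleftrightarrow> letter n x = letter n (\<pi> x)" if "x \<in> ?S" for x
      proof -
        have "\<pi> x \<in> ?S" using that permutes_in_image[OF \<open>\<pi> permutes ?S\<close>] by blast
        then have "letter n (\<pi> x) = Suc (\<rho> (c (\<pi> x)))" using c_eq by blast
        then show ?thesis using c_eq[OF that, of "c (\<pi> x)"] by simp
      qed
      then show ?thesis unfolding color_matches_def matches_def by (metis (mono_tags, lifting) Collect_cong)
    qed
  qed
qed

lemma tail_of_matches_decreasing:
  "length (filter (\<lambda>x. k \<le> x) (matches_decreasing n)) =
    card {\<pi>. \<pi> permutes {1..sum_list n} \<and> k \<le> matches n \<pi>}"
proof -
  let ?M = "image_mset (matches n) (mset_set {\<pi>. \<pi> permutes {1..sum_list n}})"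
  have "length (filter (\<lambda>x. k \<le> x) (matches_decreasing n)) = size (filter_mset (\<lambda>x. k \<le> x) ?M)"
    unfolding matches_decreasing_def by (metis mset_decreasing mset_filter size_mset)
  also have "\<dots> = card {\<pi> \<in> {\<pi>. \<pi> permutes {1..sum_list n}}. k \<le> matches n \<pi>}"
    by (simp add: filter_mset_image_mset finite_permutations)
  finally show ?thesis by simp
qed

theorem theorem1:
  fixes d q :: nat and n m :: "nat list"
  assumes "d \<ge> 1" and "q \<ge> 1"
    and "n \<in> multiplicity_vectors d q" and "m \<in> multiplicity_vectors d q"
    and "n \<prec>maj m"
  shows "\<forall>j\<in>{1..fact d}. matches_decreasing n ! (j - 1) \<le> matches_decreasing m ! (j - 1)"
proof -
  have len: "length n = q" "length m = q" and sum: "sum_list n = d" "sum_list m = d"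
    using assms(3,4) by (auto simp: multiplicity_vectors_def)
  let ?S = "{1..d}"
  let ?f = "\<lambda>i. decreasing (mset n) ! i" and ?g = "\<lambda>i. decreasing (mset m) ! i"
  have le: "(\<Sum>i<l. ?f i) \<le> (\<Sum>i<l. ?g i)" if "l \<le> q" for l
    using assms(5) that len by (cases "l = 0") (auto simp: majorized_def sum.atLeast1_atMost_eq)
  have total: "(\<Sum>i<q. ?f i) = (\<Sum>i<q. ?g i)"
    using assms(5) len by (simp add: majorized_def sum.atLeast1_atMost_eq)
  have dec: "decreasing (mset v) ! b \<le> decreasing (mset v) ! a"
    if "a \<le> b" "b < q" "length v = q" for a b and v :: "nat list"
    using sorted_decreasing[of "mset v"] that
    by (cases "a = b") (auto simp: sorted_wrt_iff_nth_less)
  obtain c where c: "c ` ?S \<subseteq> {..<q}" "\<And>i. i < q \<Longrightarrow> card {x \<in> ?S. c x = i} = ?f i"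
    "\<And>\<pi>. \<pi> permutes ?S \<Longrightarrow> color_matches ?S c \<pi> = matches n \<pi>"
    using decreasing_coloring[of n] unfolding len sum by blast
  obtain c' where c': "c' ` ?S \<subseteq> {..<q}" "\<And>i. i < q \<Longrightarrow> card {x \<in> ?S. c' x = i} = ?g i"
    "\<And>\<pi>. \<pi> permutes ?S \<Longrightarrow> color_matches ?S c' \<pi> = matches m \<pi>"
    using decreasing_coloring[of m] unfolding len sum by blast
  have tails: "tail_count ?S c k \<le> tail_count ?S c' k" for k
    by (rule tail_count_mono_majorization[where f = ?f and g = ?g and q = q])
      (use dec len le total c(1,2) c'(1,2) in auto)
  have "tail_count ?S c k = length (filter (\<lambda>x. k \<le> x) (matches_decreasing n))"
    "tail_count ?S c' k = length (filter (\<lambda>x. k \<le> x) (matches_decreasing m))" for k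
    unfolding tail_count_def tail_of_matches_decreasing sum
    by (rule arg_cong[where f = card], use c(3) c'(3) in auto)+
  with tails have
    "length (filter (\<lambda>x. k \<le> x) (matches_decreasing n)) \<le>
      length (filter (\<lambda>x. k \<le> x) (matches_decreasing m))" for k
    by simp
  then show ?thesis
    by (intro ballI nth_le_if_tails_le)
      (auto simp: matches_decreasing_def sorted_decreasing card_permutations sum)
qed

end
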